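(* Let $k\ge3$ be a fixed integer. For every $\varepsilon>0$ there exists $d_0=d_0(k,\varepsilon)$ such that every $K_{k+1}$-free graph $G$ of average degree $d\ge d_0$ satisfies $$\alpha(G)\ge(1-\varepsilon)\max\left\{\frac{\log d}{(k-2)\,d\log\log d},\ \frac1{5d}\sqrt{\frac{\log d}{\log(k-1)}}\right\}|V(G)|.$$
   Context: Graphs are finite and simple; the average degree of $G$ is $2|E(G)|/|V(G)|$, $\alpha(G)$ is the independence number, and $\log$ is the natural logarithm. $K_{k+1}$ is the complete graph on $k+1$ vertices, and $G$ is $K_{k+1}$-free if it contains no subgraph isomorphic to $K_{k+1}$. *)

theory Defs
  imports Complex_Main "HOL-Library.Ramsey"
begin

definition simple_graph :: "'a set \<Rightarrow> 'a set set \<Rightarrow> bool"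
  where "simple_graph V E \<longleftrightarrow> finite V \<and> E \<subseteq> [V]\<^bsup>2\<^esup>"

definition subgraph :: "'a set \<Rightarrow> 'a set set \<Rightarrow> 'a set \<Rightarrow> 'a set set \<Rightarrow> bool"
  where "subgraph W F V E \<longleftrightarrow> simple_graph W F \<and> W \<subseteq> V \<and> F \<subseteq> E"

definition graph_isomorphic :: "'a set \<Rightarrow> 'a set set \<Rightarrow> 'b set \<Rightarrow> 'b set set \<Rightarrow> bool"
  where "graph_isomorphic V E W F \<longleftrightarrow>
    (\<exists>f. bij_betw f V W \<and> (\<forall>u\<in>V. \<forall>v\<in>V. {u, v} \<in> E \<longleftrightarrow> {f u, f v} \<in> F))"

text \<open>The complete graph on \<open>n\<close> vertices is represented by
  \<open>({..<n}, [{..<n}]\<^bsup>2\<^esup>)\<close>.\<close>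

definition complete_free :: "nat \<Rightarrow> 'a set \<Rightarrow> 'a set set \<Rightarrow> bool"
  where "complete_free n V E \<longleftrightarrow>
    \<not> (\<exists>W F. subgraph W F V E \<and> graph_isomorphic W F {..<n} ([{..<n}]\<^bsup>2\<^esup>))"

definition average_degree :: "'a set \<Rightarrow> 'a set set \<Rightarrow> real"
  where "average_degree V E = 2 * real (card E) / real (card V)"

text \<open>\<^const>\<open>indep\<close> only tests the vertices of \<open>S\<close> pairwise, so \<open>S \<subseteq> V\<close> has to be
  required separately. For finite \<open>V\<close> the maximum is over a finite set containing \<open>0\<close>.\<close>

definition independence_number :: "'a set \<Rightarrow> 'a set set \<Rightarrow> nat"
  where "independence_number V E = Max {card S | S. S \<subseteq> V \<and> indep S E}"

end

theory Submission
  imports Defs "HOL-Real_Asymp.Real_Asymp"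
begin

text \<open>
  For fixed \<open>k\<close> and large \<open>d\<close> the first term of the maximum dominates, so the theorem is Shearer's
  bound for \<open>K\<^sub>k\<^sub>+\<^sub>1\<close>-free graphs with the constant \<open>1 / (k - 2)\<close>.

  Suppose first that all degrees are at most \<open>\<Delta>\<close>, and let \<open>I\<close> be a uniformly random independent set.
  Fix a vertex \<open>v\<close> and reveal \<open>I\<close> outside the closed neighbourhood of \<open>v\<close>. Let \<open>F\<close> be the set of the
  neighbours of \<open>v\<close> that are not adjacent to the revealed part, and let \<open>N\<close> be the number of
  independent subsets of \<open>F\<close>. Then \<open>I\<close> either contains \<open>v\<close>, with probability \<open>1 / (N + 1)\<close>, or meets
  the neighbourhood of \<open>v\<close> in a uniformly random independent subset of \<open>F\<close>. If \<open>N\<close> is small, \<open>v\<close>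
  itself is comparatively likely to be chosen. If \<open>N\<close> is large, many neighbours are chosen on average, because \<open>F\<close>
  is \<open>K\<^sub>k\<close>-free: Ramsey's theorem bounds \<open>|F|\<close> by a power of \<open>L = ln N\<close> with exponent \<open>k - 1\<close>
  (\<open>card_clique_free_le_ln\<close>), and a set of that size can only have \<open>e\<^sup>L\<close> independent subsets if their
  average size is about \<open>L / ((k - 2) ln L)\<close> (\<open>average_indep_lower\<close>, \<open>average_indep_clique_free\<close>).
  With the threshold for \<open>N\<close> at \<open>\<Delta>\<close> to a power slightly below \<open>1\<close>, summation over all \<open>v\<close>
  gives \<open>\<alpha>(G) \<ge> (1 - \<epsilon>) n ln \<Delta> / ((k - 2) \<Delta> ln (ln \<Delta>))\<close> for a graph on \<open>n\<close> vertices
  (\<open>card_le_independence_number_occupancy\<close>, \<open>shearer_bound_max_degree\<close>).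

  To replace the maximum degree by the average degree \<open>d\<close>, observe that deleting a vertex of more
  than average degree does not decrease \<open>n / d\<close>. More precisely, for \<open>q\<close> slightly above \<open>1\<close> a set of
  vertices that maximises \<open>n\<^sup>q / (d + 1)\<close> over all induced subgraphs has maximum degree at most
  \<open>(q + 1) / 2\<close> times its \<open>d + 1\<close> (\<open>exists_balanced_subset\<close>). If \<open>d\<close> shrinks on the way to this set,
  then \<open>n / d\<close> gains a small power of the shrinking factor, which outweighs the decrease of the
  logarithm (\<open>shearer_bound_average_degree\<close>).
\<close>

section \<open>Neighbourhoods, independent sets and cliques\<close>

definition neighbours :: "'a set set \<Rightarrow> 'a set \<Rightarrow> 'a \<Rightarrow> 'a set"
  where "neighbours E W v = {u \<in> W. u \<noteq> v \<and> {v, u} \<in> E}"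

definition indeps :: "'a set set \<Rightarrow> 'a set \<Rightarrow> 'a set set"
  where "indeps E W = {I. I \<subseteq> W \<and> indep I E}"

definition clique_free :: "nat \<Rightarrow> 'a set set \<Rightarrow> 'a set \<Rightarrow> bool"
  where "clique_free k E W \<longleftrightarrow> (\<forall>K \<subseteq> W. clique K E \<longrightarrow> card K \<noteq> k)"

lemma neighbours_subset: "neighbours E W v \<subseteq> W"
  by (auto simp: neighbours_def)

lemma finite_neighbours [simp]: "finite W \<Longrightarrow> finite (neighbours E W v)"
  by (simp add: neighbours_def)

lemma finite_indeps [simp]: "finite W \<Longrightarrow> finite (indeps E W)"
  by (rule finite_subset[of _ "Pow W"]) (auto simp: indeps_def)

lemma empty_in_indeps [simp]: "{} \<in> indeps E W"
  by (simp add: indeps_def)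

lemma card_indeps_pos: "finite W \<Longrightarrow> card (indeps E W) > 0"
  by (metis card_gt_0_iff empty_iff empty_in_indeps finite_indeps)

lemma clique_free_mono: "clique_free k E W \<Longrightarrow> S \<subseteq> W \<Longrightarrow> clique_free k E S"
  by (auto simp: clique_free_def)

lemma clique_free_neighbours:
  assumes "clique_free (Suc k) E W" "finite W" "v \<in> W"
  shows "clique_free k E (neighbours E W v)"
  unfolding clique_free_def
proof (intro allI impI notI)
  fix K assume K: "K \<subseteq> neighbours E W v" "clique K E" "card K = k"
  have "clique (insert v K) E"
    using K by (auto simp: clique_def neighbours_def insert_commute)
  moreover have "insert v K \<subseteq> W"
    using K assms by (auto simp: neighbours_def)
  moreover have "card (insert v K) = Suc k"
  proof -
    have "finite K" using K assms by (meson finite_neighbours finite_subset)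
    moreover have "v \<notin> K" using K by (auto simp: neighbours_def)
    ultimately show ?thesis using K by simp
  qed
  ultimately show False
    using assms(1) by (auto simp: clique_free_def)
qed

lemma complete_free_imp_clique_free:
  assumes "simple_graph V E" "complete_free n V E"
  shows "clique_free n E V"
  unfolding clique_free_def
proof (intro allI impI notI)
  fix K assume K: "K \<subseteq> V" "clique K E" "card K = n"
  have fin: "finite K" using K assms by (auto simp: simple_graph_def intro: finite_subset)
  have "[K]\<^bsup>2\<^esup> \<subseteq> E" using K by (auto simp: nsets_2_eq clique_def)
  then have sub: "subgraph K ([K]\<^bsup>2\<^esup>) V E"
    using K fin by (auto simp: subgraph_def simple_graph_def)
  obtain f where f: "bij_betw f K {..<n}"
    using K fin by (metis card_lessThan finite_lessThan finite_same_card_bij)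
  have "{u, v} \<in> [K]\<^bsup>2\<^esup> \<longleftrightarrow> {f u, f v} \<in> [{..<n}]\<^bsup>2\<^esup>" if "u \<in> K" "v \<in> K" for u v
  proof -
    have "f u = f v \<longleftrightarrow> u = v" using f that by (meson bij_betw_def inj_on_eq_iff)
    moreover have "f u \<in> {..<n}" "f v \<in> {..<n}" using f that by (auto dest: bij_betwE)
    ultimately show ?thesis using that by (auto simp: nsets_def card_2_iff)
  qed
  then have "graph_isomorphic K ([K]\<^bsup>2\<^esup>) {..<n} ([{..<n}]\<^bsup>2\<^esup>)"
    using f by (auto simp: graph_isomorphic_def)
  then show False using sub assms(2) by (auto simp: complete_free_def)
qed

section \<open>A polynomial Ramsey bound\<close>

lemma independence_number_eq: "independence_number W E = Max (card ` indeps E W)"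
  unfolding independence_number_def indeps_def by (rule arg_cong[of _ _ Max]) auto

lemma card_le_independence_number:
  "finite W \<Longrightarrow> I \<in> indeps E W \<Longrightarrow> card I \<le> independence_number W E"
  by (simp add: independence_number_eq)

lemma independence_number_attained:
  assumes "finite W"
  obtains I where "I \<in> indeps E W" "card I = independence_number W E"
proof -
  have "Max (card ` indeps E W) \<in> card ` indeps E W"
    using assms by (intro Max_in) (auto intro: empty_in_indeps)
  then show ?thesis using that by (auto simp: independence_number_eq)
qed

lemma independence_number_mono:
  assumes "finite W" "S \<subseteq> W"
  shows "independence_number S E \<le> independence_number W E"
proof -
  obtain I where "I \<in> indeps E S" "card I = independence_number S E"
    using independence_number_attained assms finite_subset by metis
  then show ?thesis
    using card_le_independence_number[OF assms(1), of I E] assms by (auto simp: indeps_def)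
qed

text \<open>
  A largest independent set is maximal, so its closed neighbourhoods cover \<open>W\<close>.
\<close>

lemma card_le_independence_number_times:
  assumes "finite W" "\<And>v. v \<in> W \<Longrightarrow> card (neighbours E W v) \<le> y"
  shows "card W \<le> independence_number W E * (y + 1)"
proof -
  obtain I where I: "I \<in> indeps E W" "card I = independence_number W E"
    using independence_number_attained assms by metis
  have fin: "finite I" and sub: "I \<subseteq> W"
    using I assms by (auto simp: indeps_def intro: finite_subset)
  have "W \<subseteq> (\<Union>u\<in>I. insert u (neighbours E W u))"
  proof
    fix w assume w: "w \<in> W"
    show "w \<in> (\<Union>u\<in>I. insert u (neighbours E W u))"
    proof (rule ccontr)
      assume neg: "w \<notin> (\<Union>u\<in>I. insert u (neighbours E W u))"
      then have "w \<notin> I" by auto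
      moreover have "insert w I \<in> indeps E W"
        using I w neg by (auto simp: indeps_def indep_def neighbours_def insert_commute)
      ultimately show False
        using card_le_independence_number[OF assms(1), of "insert w I" E] I fin by simp
    qed
  qed
  then have "card W \<le> card (\<Union>u\<in>I. insert u (neighbours E W u))"
    using assms fin sub by (intro card_mono) auto
  also have "\<dots> \<le> (\<Sum>u\<in>I. card (insert u (neighbours E W u)))"
    using fin by (rule card_UN_le)
  also have "\<dots> \<le> (\<Sum>u\<in>I. y + 1)"
    using assms sub by (intro sum_mono) (auto simp: card_insert_if le_SucI subset_iff)
  finally show ?thesis using I by simp
qed

text \<open>
  Neighbourhoods contain only smaller cliques, so by induction they are small, and then the degree
  bound above applies. Adding one on both sides makes the induction close without error terms.
\<close>

lemma card_clique_free_le: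
  assumes "finite W" "clique_free (Suc k) E W"
  shows "card W + 1 \<le> (independence_number W E + 1) ^ k"
  using assms
proof (induction k arbitrary: W)
  case 0
  have "x \<notin> W" for x
  proof
    assume "x \<in> W"
    moreover have "clique {x} E" by (simp add: clique_def)
    ultimately show False using 0 by (auto simp: clique_free_def dest!: spec[of _ "{x}"])
  qed
  then have "W = {}" by auto
  then show ?case by simp
next
  case (Suc k)
  let ?a = "independence_number W E"
  have deg: "card (neighbours E W v) \<le> (?a + 1) ^ k - 1" if "v \<in> W" for v
  proof -
    have "card (neighbours E W v) + 1 \<le> (independence_number (neighbours E W v) E + 1) ^ k"
      using Suc that by (intro Suc.IH clique_free_neighbours) auto
    also have "\<dots> \<le> (?a + 1) ^ k"
      using independence_number_mono[OF Suc.prems(1) neighbours_subset] by (intro power_mono) auto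
    finally show ?thesis by simp
  qed
  have "card W \<le> ?a * ((?a + 1) ^ k - 1 + 1)"
    using Suc.prems deg by (intro card_le_independence_number_times) auto
  then have "card W + 1 \<le> ?a * (?a + 1) ^ k + 1" by simp
  also have "\<dots> \<le> (?a + 1) ^ Suc k" by (simp add: Suc_le_eq)
  finally show ?case .
qed

section \<open>The average size of an independent set\<close>

text \<open>
  All subsets of an independent set are independent.
\<close>

lemma two_power_independence_number_le:
  assumes "finite W"
  shows "2 ^ independence_number W E \<le> card (indeps E W)"
proof -
  obtain I where I: "I \<in> indeps E W" "card I = independence_number W E"
    using independence_number_attained assms by metis
  have "finite I" using I assms by (auto simp: indeps_def intro: finite_subset)
  then have "2 ^ card I = card (Pow I)" by (simp add: card_Pow)
  also have "\<dots> \<le> card (indeps E W)"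
    using I assms by (intro card_mono) (auto simp: indeps_def indep_def)
  finally show ?thesis using I by simp
qed

text \<open>
  Let there be \<open>N\<close> independent sets, of average size \<open>A\<close>, on \<open>x\<close> vertices. The independence
  polynomial at \<open>t\<close>, the sum of \<open>t\<close> to the power \<open>|I|\<close>, is at least \<open>N t\<^sup>A\<close> by Jensen's inequality,
  and at most the polynomial \<open>(1 + t)\<^sup>x\<close> of the edgeless graph. Hence
  \<open>N t\<^sup>A \<le> (1 + t)\<^sup>x \<le> e\<^sup>t\<^sup>x\<close>; the statement is its logarithm, multiplied by \<open>N\<close> so that sums appear in place of averages. It is used with a
  small \<open>t\<close>.
\<close>

lemma average_indep_lower:
  fixes t :: real and E :: "'a set set" and W :: "'a set"
  assumes "finite W" "0 < t"
  defines "N \<equiv> real (card (indeps E W))"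
  shows "N * (ln N - t * card W) \<le> (\<Sum>I\<in>indeps E W. real (card I)) * ln (1 / t)"
proof -
  define A where "A = (\<Sum>I\<in>indeps E W. real (card I)) / N"
  have N: "N > 0" using card_indeps_pos[OF assms(1)] by (simp add: N_def)
  have "N * t powr A = (\<Sum>I\<in>indeps E W. t powr A * (1 + (real (card I) - A) * ln t))"
    using N by (simp add: sum_distrib_left[symmetric] sum.distrib sum_distrib_right[symmetric]
        sum_subtractf A_def N_def)
  \<comment> \<open>Jensen's inequality, from the tangent line of the exponential function at the mean.\<close>
  also have "\<dots> \<le> (\<Sum>I\<in>indeps E W. t ^ card I)"
  proof (rule sum_mono)
    fix I
    have "1 + (real (card I) - A) * ln t \<le> exp ((real (card I) - A) * ln t)"
      by (rule exp_ge_add_one_self)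
    also have "\<dots> = t powr (real (card I) - A)" using assms by (simp add: powr_def)
    finally have "t powr A * (1 + (real (card I) - A) * ln t) \<le> t powr A * t powr (real (card I) - A)"
      by (intro mult_left_mono) auto
    also have "\<dots> = t ^ card I"
      using assms by (simp add: powr_add[symmetric] powr_realpow)
    finally show "t powr A * (1 + (real (card I) - A) * ln t) \<le> t ^ card I" .
  qed
  also have "\<dots> \<le> (\<Sum>I\<in>Pow W. t ^ card I)"
    using assms by (intro sum_mono2) (auto simp: indeps_def)
  also have "\<dots> = (1 + t) ^ card W"
    using prod_add[OF assms(1), of "\<lambda>_. t" "\<lambda>_. 1"] by (simp add: add.commute)
  also have "\<dots> \<le> exp t ^ card W"
    using assms by (intro power_mono) auto
  also have "\<dots> = exp (t * card W)" by (rule exp_of_nat2_mult[symmetric])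
  finally have "ln (N * t powr A) \<le> t * card W"
    using N assms by (metis ln_exp ln_mono mult_pos_pos powr_gt_zero less_irrefl)
  then have "ln N - t * card W \<le> A * ln (1 / t)"
    using N assms(2) by (simp add: ln_mult_pos ln_powr ln_div)
  then have "N * (ln N - t * card W) \<le> N * (A * ln (1 / t))"
    using N by (intro mult_left_mono) auto
  then show ?thesis using N by (simp add: A_def)
qed

text \<open>
  Many vertices force a large independent set, hence many independent sets: the number of vertices
  is at most polynomial in the logarithm of the number of independent sets. The constant \<open>3\<close> is a
  convenient bound for \<open>1 + 1 / ln 2\<close>.
\<close>

lemma card_clique_free_le_ln:
  assumes "finite W" "clique_free (Suc k) E W" "ln (real (card (indeps E W))) \<ge> 1"
  shows "real (card W) \<le> (3 * ln (real (card (indeps E W)))) ^ k"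
proof -
  define L where "L = ln (real (card (indeps E W)))"
  have N: "real (card (indeps E W)) > 0" using card_indeps_pos[OF assms(1)] by simp
  have "real (2 ^ independence_number W E) \<le> real (card (indeps E W))"
    using two_power_independence_number_le[OF assms(1)] by (intro of_nat_mono)
  then have "ln (real (2 ^ independence_number W E)) \<le> L"
    using N unfolding L_def by (subst ln_le_cancel_iff) auto
  then have "independence_number W E * ln 2 \<le> L" by (simp add: ln_realpow)
  moreover have "ln (2::real) \<ge> 1 / 2" using ln_le_minus_one[of "1/2::real"] by (simp add: ln_div)
  then have "independence_number W E * (1/2) \<le> independence_number W E * ln (2::real)"
    by (intro mult_left_mono) auto
  ultimately have "real (independence_number W E) + 1 \<le> 3 * L"
    using assms(3) by (simp add: L_def)
  then have "(real (independence_number W E) + 1) ^ k \<le> (3 * L) ^ k"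
    by (intro power_mono) auto
  moreover have "real (card W + 1) \<le> real ((independence_number W E + 1) ^ k)"
    using card_clique_free_le[OF assms(1,2)] by (intro of_nat_mono)
  ultimately show ?thesis by (simp add: L_def algebra_simps)
qed

text \<open>
  Let \<open>L = ln N\<close>, where \<open>N\<close> is the number of independent sets. In the inequality
  \<open>L - t x \<le> A ln (1 / t)\<close> above, \<open>x\<close> is at most of order \<open>L\<^sup>k\<^sup>+\<^sup>1\<close>, so a \<open>t\<close> of order \<open>L\<^sup>-\<^sup>k\<close> makes the
  loss \<open>t x\<close> a small fraction of \<open>L\<close>, while \<open>ln (1 / t)\<close> is only about \<open>k ln L\<close>. The
  coefficient of \<open>ln L\<close> is one less than the exponent in the bound for \<open>x\<close>.
\<close>

lemma average_indep_clique_free: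
  fixes \<eta> :: real and E :: "'a set set" and W :: "'a set"
  assumes "finite W" "clique_free (k + 2) E W" "0 < \<eta>" "\<eta> < 1"
  defines "N \<equiv> real (card (indeps E W))"
  assumes "ln N \<ge> 1"
  shows "N * ((1 - \<eta>) * ln N) \<le>
    (\<Sum>I\<in>indeps E W. real (card I)) * (k * ln (ln N) + ((real k + 1) * ln 3 + ln (1 / \<eta>)))"
proof -
  define L where "L = ln N"
  define t where "t = \<eta> * L / (3 * L) ^ (k + 1)"
  have L: "L \<ge> 1" using assms by (simp add: L_def)
  have N: "N > 0" using card_indeps_pos[OF assms(1)] by (simp add: N_def)
  have t: "t > 0" using L assms by (simp add: t_def)
  have "card W \<le> (3 * L) ^ (k + 1)"
    using card_clique_free_le_ln[of W "k + 1" E] assms by (simp add: L_def N_def)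
  then have "t * card W \<le> t * (3 * L) ^ (k + 1)"
    using t by (intro mult_left_mono) auto
  also have "\<dots> = \<eta> * L" using L by (simp add: t_def)
  finally have "N * ((1 - \<eta>) * L) \<le> N * (L - t * card W)"
    using N by (intro mult_left_mono) (auto simp: algebra_simps)
  also have "\<dots> \<le> (\<Sum>I\<in>indeps E W. real (card I)) * ln (1 / t)"
    unfolding L_def N_def using assms(1) t by (intro average_indep_lower)
  also have "ln (1 / t) = k * ln L + ((real k + 1) * ln 3 + ln (1 / \<eta>))"
  proof -
    have "ln (1 / t) = - ln t" using t by (simp add: ln_div)
    also have "ln t = ln \<eta> + ln L - (k + 1) * (ln 3 + ln L)"
      using L assms by (simp add: t_def ln_div ln_mult ln_realpow algebra_simps del: power_Suc)
    finally show ?thesis using assms by (simp add: ln_div algebra_simps)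
  qed
  finally show ?thesis by (simp add: L_def)
qed

text \<open>
  The bound of the previous lemma, as a function of \<open>L\<close>, is increasing once \<open>ln L \<ge> 1\<close>, so it may be
  evaluated at any lower bound \<open>x\<close> for the logarithm of the number of independent sets.
\<close>

lemma average_indep_threshold:
  fixes \<eta> :: real and E :: "'a set set" and W :: "'a set"
  assumes "finite W" "clique_free (k + 2) E W" "0 < \<eta>" "\<eta> < 1"
    and x: "ln x \<ge> 1" "x > 0" and N: "exp x \<le> real (card (indeps E W))"
  shows "real (card (indeps E W)) * ((1 - \<eta>) * x) \<le>
    (\<Sum>I\<in>indeps E W. real (card I)) * (k * ln x + ((real k + 1) * ln 3 + ln (1 / \<eta>)))"
proof -
  define c where "c = (real k + 1) * ln 3 + ln (1 / \<eta>)"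
  define S where "S = (\<Sum>I\<in>indeps E W. real (card I))"
  define n where "n = real (card (indeps E W))"
  define L where "L = ln n"
  have n: "n > 0" using card_indeps_pos[OF assms(1)] by (simp add: n_def)
  have c: "c > 0" using assms(3,4) by (simp add: c_def add_pos_pos)
  have "x \<le> L" using N n by (simp add: L_def n_def ln_ge_iff)
  moreover have "x \<ge> 1" using x by (smt (verit) ln_ge_zero_iff)
  ultimately have L: "x \<le> L" "1 \<le> x" "1 \<le> L" by auto
  have avg: "n * ((1 - \<eta>) * L) \<le> S * (k * ln L + c)"
    using average_indep_clique_free[OF assms(1-4)] L by (simp add: S_def n_def L_def c_def)
  have pos: "k * ln L + c > 0" using c L by (simp add: add_nonneg_pos)
  \<comment> \<open>This is the monotonicity of \<open>L / ln L\<close>.\<close>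
  have "x * ln L \<le> L * ln x"
  proof -
    have "ln L - ln x = ln (L / x)" using L by (simp add: ln_div)
    also have "\<dots> \<le> L / x - 1" using L by (intro ln_le_minus_one) auto
    finally have "x * (ln L - ln x) \<le> x * (L / x - 1)" using L by (intro mult_left_mono) auto
    also have "\<dots> = L - x" using L by (simp add: right_diff_distrib)
    also have "\<dots> \<le> (L - x) * ln x" using L x by (simp add: mult_le_cancel_left1)
    finally show ?thesis by (simp add: algebra_simps)
  qed
  then have "k * (x * ln L) \<le> k * (L * ln x)" by (intro mult_left_mono) auto
  moreover have "c * x \<le> c * L" using c L by simp
  ultimately have mono: "x * (k * ln L + c) \<le> L * (k * ln x + c)"
    by (simp add: algebra_simps)
  have "(n * ((1 - \<eta>) * x)) * (k * ln L + c) = (n * (1 - \<eta>)) * (x * (k * ln L + c))"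
    by simp
  also have "\<dots> \<le> (n * (1 - \<eta>)) * (L * (k * ln x + c))"
    using n assms(4) mono by (intro mult_left_mono) auto
  also have "\<dots> = n * ((1 - \<eta>) * L) * (k * ln x + c)" by simp
  also have "\<dots> \<le> S * (k * ln L + c) * (k * ln x + c)"
    using avg c L by (intro mult_right_mono) (auto intro!: add_nonneg_nonneg mult_nonneg_nonneg)
  also have "\<dots> = (S * (k * ln x + c)) * (k * ln L + c)" by simp
  finally show ?thesis using pos by (simp add: S_def n_def c_def)
qed

section \<open>A uniformly random independent set\<close>

text \<open>
  The inequality says that \<open>\<beta>\<close> times the indicator of \<open>v \<in> I\<close> plus \<open>\<gamma>\<close> times \<open>|I \<inter> N(v)|\<close> has
  expectation at least \<open>1\<close> for a uniformly random independent set \<open>I\<close>. It already holds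
  conditionally on the part \<open>J\<close> of \<open>I\<close> outside the closed neighbourhood of \<open>v\<close>: with \<open>W\<close> the set of
  neighbours of \<open>v\<close> not adjacent to \<open>J\<close>, the possible \<open>I\<close> are \<open>J\<close> together with \<open>v\<close>, and \<open>J\<close> together
  with any independent subset of \<open>W\<close>. The hypothesis is the conditional inequality, times the number
  of these sets.
\<close>

lemma card_indeps_le_occupancy:
  fixes \<beta> \<gamma> :: real
  assumes "finite V" "v \<in> V"
    and loc: "\<And>W. W \<subseteq> neighbours E V v \<Longrightarrow>
      real (card (indeps E W)) + 1 \<le> \<beta> + \<gamma> * (\<Sum>I\<in>indeps E W. real (card I))"
  shows "real (card (indeps E V)) \<le>
    (\<Sum>I\<in>indeps E V. \<beta> * of_bool (v \<in> I) + \<gamma> * real (card (I \<inter> neighbours E V v)))"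
proof -
  define M where "M = neighbours E V v"
  define h where "h I = \<beta> * of_bool (v \<in> I) + \<gamma> * real (card (I \<inter> M))" for I
  \<comment> \<open>The fibres of \<open>g\<close> are the events that are conditioned on.\<close>
  define g where "g I = I - insert v M" for I
  have M: "finite M" "v \<notin> M" "M \<subseteq> V" using assms by (auto simp: M_def neighbours_def)
  have fibre: "real (card {I \<in> indeps E V. g I = J}) \<le> sum h {I \<in> indeps E V. g I = J}"
    if "J \<in> g ` indeps E V" for J
  proof -
    have J: "J \<in> indeps E V" "J \<inter> insert v M = {}"
      using that by (auto simp: indeps_def indep_def g_def)
    define W where "W = {u \<in> M. \<forall>w\<in>J. {u, w} \<notin> E}"
    have W: "W \<subseteq> M" by (auto simp: W_def)
    have eq: "{I \<in> indeps E V. g I = J} = insert (insert v J) ((\<union>) J ` indeps E W)"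
    proof (intro equalityI subsetI)
      fix I assume I: "I \<in> {I \<in> indeps E V. g I = J}"
      show "I \<in> insert (insert v J) ((\<union>) J ` indeps E W)"
      proof (cases "v \<in> I")
        case True
        then have "I \<inter> M = {}"
          using I by (auto simp: M_def neighbours_def indeps_def indep_def)
        then have "I = insert v J" using I True by (auto simp: g_def)
        then show ?thesis by simp
      next
        case False
        then have "I = J \<union> (I \<inter> M)" using I by (auto simp: g_def)
        moreover have "I \<inter> M \<in> indeps E W"
          using I by (auto simp: indeps_def indep_def W_def g_def)
        ultimately show ?thesis by blast
      qed
    next
      fix I assume "I \<in> insert (insert v J) ((\<union>) J ` indeps E W)"
      then consider "I = insert v J" | K where "I = J \<union> K" "K \<in> indeps E W" by blast
      then show "I \<in> {I \<in> indeps E V. g I = J}"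
      proof cases
        case 1
        have "indep (insert v J) E"
          using J assms(2) by (auto simp: indeps_def indep_def M_def neighbours_def insert_commute)
        then show ?thesis using 1 J assms(2) M by (auto simp: indeps_def g_def)
      next
        case 2
        have "indep (J \<union> K) E"
          using J 2 by (auto simp: indeps_def indep_def W_def subset_iff) (metis insert_commute)
        then show ?thesis using 2 J W M by (auto simp: indeps_def g_def)
      qed
    qed
    have finW: "finite W" using W M finite_subset by blast
    have inj: "inj_on ((\<union>) J) (indeps E W)"
      using J W by (intro inj_on_inverseI[where g = "\<lambda>X. X \<inter> M"]) (auto simp: indeps_def)
    have notin: "insert v J \<notin> (\<union>) J ` indeps E W"
      using J W M by (auto simp: indeps_def)
    have "real (card {I \<in> indeps E V. g I = J}) = real (card (indeps E W)) + 1"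
      unfolding eq using finW inj notin by (simp add: card_image)
    also have "\<dots> \<le> \<beta> + \<gamma> * (\<Sum>I\<in>indeps E W. real (card I))"
      using W by (intro loc) (simp add: M_def)
    also have "\<dots> = h (insert v J) + (\<Sum>K\<in>indeps E W. h (J \<union> K))"
    proof -
      have "insert v J \<inter> M = {}" using J M by auto
      then have "h (insert v J) = \<beta>" by (simp add: h_def)
      moreover have "h (J \<union> K) = \<gamma> * real (card K)" if "K \<in> indeps E W" for K
      proof -
        have "(J \<union> K) \<inter> M = K" "v \<notin> J \<union> K" using that J W M by (auto simp: indeps_def)
        then show ?thesis by (simp add: h_def)
      qed
      ultimately show ?thesis by (simp add: sum_distrib_left)
    qed
    also have "\<dots> = sum h {I \<in> indeps E V. g I = J}"
      unfolding eq using finW inj notin by (simp add: sum.reindex)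
    finally show ?thesis .
  qed
  have fin: "finite (indeps E V)" using assms by simp
  have "real (card (indeps E V)) = (\<Sum>I\<in>indeps E V. 1)" by simp
  also have "\<dots> = (\<Sum>J\<in>g ` indeps E V. \<Sum>I\<in>{I \<in> indeps E V. g I = J}. 1)"
    by (rule sum.image_gen[OF fin])
  also have "\<dots> \<le> (\<Sum>J\<in>g ` indeps E V. sum h {I \<in> indeps E V. g I = J})"
    by (rule sum_mono) (use fibre in simp)
  also have "\<dots> = sum h (indeps E V)"
    by (rule sum.image_gen[OF fin, symmetric])
  finally show ?thesis by (simp add: h_def M_def)
qed

lemma sum_card_Int_neighbours:
  assumes "finite V" "I \<subseteq> V"
  shows "(\<Sum>v\<in>V. card (I \<inter> neighbours E V v)) = (\<Sum>u\<in>I. card (neighbours E V u))"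
proof -
  have "(\<Sum>v\<in>V. card {u \<in> I. v \<in> neighbours E V u}) = (\<Sum>u\<in>I. card (neighbours E V u))"
    using assms finite_subset[OF assms(2,1)]
    by (intro sum_multicount_gen) (auto simp: neighbours_def intro!: arg_cong[of _ _ card])
  moreover have "I \<inter> neighbours E V v = {u \<in> I. v \<in> neighbours E V u}" if "v \<in> V" for v
    using that assms by (auto simp: neighbours_def insert_commute)
  ultimately show ?thesis by simp
qed

text \<open>
  Sum the occupancy inequality over all \<open>v\<close>. A vertex \<open>u \<in> I\<close> is counted with weight \<open>\<beta>\<close> for itself
  and \<open>\<gamma>\<close> for each of its neighbours, so each \<open>I\<close> contributes at most \<open>|I| (\<beta> + \<gamma> \<Delta>)\<close>.
\<close>

lemma card_le_independence_number_occupancy: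
  fixes \<beta> \<gamma> \<Delta> :: real
  assumes "finite V" "\<gamma> \<ge> 0" "\<beta> + \<gamma> * \<Delta> \<ge> 0"
    and loc: "\<And>v W. v \<in> V \<Longrightarrow> W \<subseteq> neighbours E V v \<Longrightarrow>
      real (card (indeps E W)) + 1 \<le> \<beta> + \<gamma> * (\<Sum>I\<in>indeps E W. real (card I))"
    and deg: "\<And>v. v \<in> V \<Longrightarrow> real (card (neighbours E V v)) \<le> \<Delta>"
  shows "real (card V) \<le> real (independence_number V E) * (\<beta> + \<gamma> * \<Delta>)"
proof -
  define n where "n = real (card (indeps E V))"
  have n: "n > 0" using card_indeps_pos[OF assms(1)] by (simp add: n_def)
  have "card V * n = (\<Sum>v\<in>V. n)" by simp
  also have "\<dots> \<le> (\<Sum>v\<in>V. \<Sum>I\<in>indeps E V.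
      \<beta> * of_bool (v \<in> I) + \<gamma> * real (card (I \<inter> neighbours E V v)))"
    unfolding n_def using assms(1) loc by (intro sum_mono card_indeps_le_occupancy)
  also have "\<dots> = (\<Sum>I\<in>indeps E V. \<Sum>v\<in>V.
      \<beta> * of_bool (v \<in> I) + \<gamma> * real (card (I \<inter> neighbours E V v)))"
    by (rule sum.swap)
  also have "\<dots> \<le> (\<Sum>I\<in>indeps E V. real (independence_number V E) * (\<beta> + \<gamma> * \<Delta>))"
  proof (rule sum_mono)
    fix I assume I: "I \<in> indeps E V"
    then have sub: "I \<subseteq> V" by (simp add: indeps_def)
    have "(\<Sum>v\<in>V. real (card (I \<inter> neighbours E V v))) = (\<Sum>u\<in>I. real (card (neighbours E V u)))"
      using sum_card_Int_neighbours[OF assms(1) sub, of E] by (metis of_nat_sum)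
    also have "\<dots> \<le> (\<Sum>u\<in>I. \<Delta>)" using sub deg by (intro sum_mono) auto
    finally have "\<gamma> * (\<Sum>v\<in>V. real (card (I \<inter> neighbours E V v))) \<le> \<gamma> * (card I * \<Delta>)"
      using assms(2) by (intro mult_left_mono) auto
    moreover have "(\<Sum>v\<in>V. of_bool (v \<in> I) :: real) = card I"
    proof -
      have "V \<inter> I = I" using sub by blast
      then show ?thesis using assms(1) by (simp add: of_bool_def sum.If_cases)
    qed
    ultimately have "(\<Sum>v\<in>V. \<beta> * of_bool (v \<in> I) + \<gamma> * real (card (I \<inter> neighbours E V v)))
        \<le> card I * (\<beta> + \<gamma> * \<Delta>)"
      by (simp add: sum.distrib sum_distrib_left[symmetric] algebra_simps)
    also have "\<dots> \<le> real (independence_number V E) * (\<beta> + \<gamma> * \<Delta>)"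
      using card_le_independence_number[OF assms(1) I] assms(3) by (intro mult_right_mono) auto
    finally show "(\<Sum>v\<in>V. \<beta> * of_bool (v \<in> I) + \<gamma> * real (card (I \<inter> neighbours E V v)))
        \<le> real (independence_number V E) * (\<beta> + \<gamma> * \<Delta>)" .
  qed
  also have "\<dots> = (real (independence_number V E) * (\<beta> + \<gamma> * \<Delta>)) * n"
    by (simp add: n_def)
  finally show ?thesis using n by simp
qed

text \<open>
  Here \<open>\<beta> = e\<^sup>x + 1\<close>, and \<open>1 / \<gamma>\<close> is the lower bound for the average size of an independent set among
  at least \<open>e\<^sup>x\<close>. A set of neighbours with fewer than \<open>e\<^sup>x\<close> independent subsets is paid for by \<open>\<beta>\<close>,
  and any other by the term with \<open>\<gamma>\<close>.
\<close>

lemma card_le_independence_number_clique_free: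
  fixes \<eta> \<Delta> x :: real
  assumes "finite V" "clique_free (k + 3) E V" "0 < \<eta>" "\<eta> < 1" "ln x \<ge> 1" "x > 0" "\<Delta> \<ge> 0"
    and deg: "\<And>v. v \<in> V \<Longrightarrow> real (card (neighbours E V v)) \<le> \<Delta>"
  shows "real (card V) \<le> real (independence_number V E) *
    (exp x + 1 + (k * ln x + ((real k + 1) * ln 3 + ln (1 / \<eta>))) / ((1 - \<eta>) * x) * \<Delta>)"
proof -
  define \<gamma> where "\<gamma> = (k * ln x + ((real k + 1) * ln 3 + ln (1 / \<eta>))) / ((1 - \<eta>) * x)"
  have den: "(1 - \<eta>) * x > 0" using assms by simp
  have "x \<ge> 1" using assms(5,6) by (smt (verit) ln_ge_zero_iff)
  have \<gamma>: "\<gamma> \<ge> 0"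
    unfolding \<gamma>_def using assms \<open>x \<ge> 1\<close>
    by (intro divide_nonneg_nonneg add_nonneg_nonneg mult_nonneg_nonneg) auto
  have loc: "real (card (indeps E W)) + 1 \<le> exp x + 1 + \<gamma> * (\<Sum>I\<in>indeps E W. real (card I))"
    if "v \<in> V" "W \<subseteq> neighbours E V v" for v W
  proof (cases "exp x \<le> real (card (indeps E W))")
    case False
    have "0 \<le> \<gamma> * (\<Sum>I\<in>indeps E W. real (card I))"
      using \<gamma> by (intro mult_nonneg_nonneg sum_nonneg) auto
    then show ?thesis using False by linarith
  next
    case True
    have "finite W" using that assms(1) finite_subset by (metis finite_neighbours)
    moreover have "clique_free (k + 2) E W"
    proof -
      have "clique_free (Suc (k + 2)) E V" using assms(2) by (simp add: numeral_3_eq_3)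
      from clique_free_neighbours[OF this assms(1) that(1)] show ?thesis
        using that(2) by (rule clique_free_mono)
    qed
    ultimately have "real (card (indeps E W)) * ((1 - \<eta>) * x) \<le>
      (\<Sum>I\<in>indeps E W. real (card I)) * (k * ln x + ((real k + 1) * ln 3 + ln (1 / \<eta>)))"
      using assms True by (intro average_indep_threshold)
    then have "real (card (indeps E W)) \<le> \<gamma> * (\<Sum>I\<in>indeps E W. real (card I))"
      unfolding \<gamma>_def using den by (simp add: pos_le_divide_eq mult.commute)
    then show ?thesis using exp_ge_zero[of x] by linarith
  qed
  show ?thesis
    unfolding \<gamma>_def[symmetric]
    using assms(1) \<gamma> loc deg
    by (intro card_le_independence_number_occupancy) (auto simp: assms(7) intro!: add_nonneg_nonneg)
qed

section \<open>Passing from average degree to maximum degree\<close>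

definition degree_sum :: "'a set set \<Rightarrow> 'a set \<Rightarrow> nat"
  where "degree_sum E S = (\<Sum>v\<in>S. card (neighbours E S v))"

lemma degree_sum_remove:
  assumes "finite S" "v \<in> S"
  shows "degree_sum E S = degree_sum E (S - {v}) + 2 * card (neighbours E S v)"
proof -
  have card_nb: "card (neighbours E S u)
      = card (neighbours E (S - {v}) u) + of_bool (u \<in> neighbours E S v)" if "u \<in> S - {v}" for u
  proof -
    have fin: "finite (neighbours E (S - {v}) u)" using assms by simp
    have notin: "v \<notin> neighbours E (S - {v}) u" by (simp add: neighbours_def)
    have "neighbours E S u = (if u \<in> neighbours E S v
        then insert v (neighbours E (S - {v}) u) else neighbours E (S - {v}) u)"
      using that assms by (auto simp: neighbours_def insert_commute)
    then show ?thesis using fin notin by simp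
  qed
  have "(\<Sum>u\<in>S - {v}. of_bool (u \<in> neighbours E S v) :: nat)
      = card ((S - {v}) \<inter> neighbours E S v)"
    using assms by (simp add: of_bool_def sum.If_cases)
  also have "(S - {v}) \<inter> neighbours E S v = neighbours E S v" by (auto simp: neighbours_def)
  finally have "(\<Sum>u\<in>S - {v}. card (neighbours E S u))
      = degree_sum E (S - {v}) + card (neighbours E S v)"
    using card_nb by (simp add: degree_sum_def sum.distrib)
  then show ?thesis using assms by (simp add: degree_sum_def sum.remove[of S v])
qed

lemma degree_sum_eq_twice_card_edges:
  assumes "simple_graph V E"
  shows "degree_sum E V = 2 * card E"
proof -
  have fin: "finite V" and E: "E \<subseteq> [V]\<^bsup>2\<^esup>" using assms by (auto simp: simple_graph_def)
  then have finE: "finite E" using finite_imp_finite_nsets finite_subset by metis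
  have "card (neighbours E V v) = card {e \<in> E. v \<in> e}" if "v \<in> V" for v
  proof (rule bij_betw_same_card)
    show "bij_betw (\<lambda>u. {v, u}) (neighbours E V v) {e \<in> E. v \<in> e}"
      unfolding bij_betw_def
    proof (intro conjI equalityI subsetI)
      show "inj_on (\<lambda>u. {v, u}) (neighbours E V v)"
        by (auto simp: inj_on_def doubleton_eq_iff)
    next
      fix e assume "e \<in> {e \<in> E. v \<in> e}"
      then have e: "e \<in> E" "v \<in> e" by auto
      then obtain a b where "e = {a, b}" "a \<in> V" "b \<in> V" "a \<noteq> b" using E by (meson nsets2_E subsetD)
      then show "e \<in> (\<lambda>u. {v, u}) ` neighbours E V v"
        using e by (auto simp: neighbours_def image_iff insert_commute)
    qed (auto simp: neighbours_def)
  qed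
  then have "degree_sum E V = (\<Sum>v\<in>V. card {e \<in> E. v \<in> e})" by (simp add: degree_sum_def)
  also have "\<dots> = (\<Sum>e\<in>E. 2)"
  proof (rule sum_multicount_gen)
    show "\<forall>e\<in>E. card {v \<in> V. v \<in> e} = 2"
    proof
      fix e assume "e \<in> E"
      then have "e \<subseteq> V" "card e = 2" using E by (auto simp: nsets_def)
      moreover from this have "{v \<in> V. v \<in> e} = e" by auto
      ultimately show "card {v \<in> V. v \<in> e} = 2" by simp
    qed
  qed (use fin finE in auto)
  finally show ?thesis by simp
qed

lemma Bernoulli_inequality_powr:
  fixes x p :: real
  assumes "p \<ge> 1" "x > 0"
  shows "1 + p * (x - 1) \<le> x powr p"
proof (cases "1 + p * (x - 1) > 0")
  case False
  then show ?thesis using powr_ge_zero[of x p] by linarith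
next
  case True
  define w where "w = 1 + p * (x - 1)"
  have w: "w > 0" using True by (simp add: w_def)
  have 1: "ln w - ln x \<le> w / x - 1"
    using ln_le_minus_one[of "w / x"] w assms by (simp add: ln_div)
  have "- ln x \<le> 1 / x - 1"
    using ln_le_minus_one[of "1 / x"] assms by (simp add: ln_div)
  then have "(p - 1) * (- ln x) \<le> (p - 1) * (1 / x - 1)"
    using assms by (intro mult_left_mono) auto
  moreover have "w / x - 1 + (p - 1) * (1 / x - 1) = 0"
    using assms by (simp add: w_def field_simps)
  ultimately have "ln w \<le> p * ln x" using 1 by (simp add: algebra_simps)
  then have "w \<le> exp (p * ln x)" using w by (metis exp_le_cancel_iff exp_ln)
  then show ?thesis using assms by (simp add: w_def powr_def)
qed

text \<open>
  Let \<open>S\<close> maximise \<open>|S|\<^sup>q / (d\<^sub>S + 1)\<close>, where \<open>d\<^sub>S\<close> is the average degree of the subgraph induced by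
  \<open>S\<close>. Deleting a vertex of degree \<open>D\<close> multiplies this quantity by about
  \<open>(1 - (q + 1) / |S|) / (1 - (2 D + 1) / (|S| (d\<^sub>S + 1)))\<close>, so maximality bounds every degree in \<open>S\<close>
  by about \<open>(q + 1) / 2\<close> times \<open>d\<^sub>S + 1\<close>. For \<open>q\<close> slightly larger than \<open>1\<close> the maximum degree is
  thus nearly the average degree. The summand \<open>1\<close> keeps edgeless sets harmless.
\<close>

lemma exists_balanced_subset:
  fixes q :: real
  assumes "finite V" "V \<noteq> {}" "q \<ge> 0"
  obtains S where "S \<subseteq> V" "S \<noteq> {}"
    "real (card V) powr q / (degree_sum E V / card V + 1)
       \<le> real (card S) powr q / (degree_sum E S / card S + 1)"
    "\<And>v. v \<in> S \<Longrightarrow> 2 * real (card (neighbours E S v)) + 1 \<le> (q + 1) * (degree_sum E S / card S + 1)"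
proof -
  define \<psi> where "\<psi> S = real (card S) powr (q + 1) / (degree_sum E S + card S)" for S
  have \<psi>: "\<psi> S = real (card S) powr q / (degree_sum E S / card S + 1)"
    if "finite S" "S \<noteq> {}" for S
  proof -
    have "real (card S) > 0" using that by (simp add: card_gt_0_iff)
    then show ?thesis by (simp add: \<psi>_def powr_add field_simps)
  qed
  \<comment> \<open>\<open>\<psi>\<close> is the quantity to be maximised, with numerator and denominator multiplied by \<open>|S|\<close>.\<close>
  define A where "A = Pow V - {{}}"
  have A: "finite A" "A \<noteq> {}" using assms by (auto simp: A_def)
  then have "Max (\<psi> ` A) \<in> \<psi> ` A" by (intro Max_in) auto
  then obtain S where S: "S \<in> A" "\<psi> S = Max (\<psi> ` A)" by auto
  have max: "\<psi> T \<le> \<psi> S" if "T \<in> A" for T using that A S by simp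
  have sub: "S \<subseteq> V" "S \<noteq> {}" using S by (auto simp: A_def)
  then have fin: "finite S" using assms finite_subset by blast
  have "\<psi> V \<le> \<psi> S" using assms by (intro max) (auto simp: A_def)
  then have "real (card V) powr q / (degree_sum E V / card V + 1)
       \<le> real (card S) powr q / (degree_sum E S / card S + 1)"
    using \<psi> assms sub fin by simp
  moreover have "2 * real (card (neighbours E S v)) + 1 \<le> (q + 1) * (degree_sum E S / card S + 1)"
    if v: "v \<in> S" for v
  proof (cases "S = {v}")
    case True
    then have "neighbours E S v = {}" by (auto simp: neighbours_def)
    moreover have "1 * 1 \<le> (q + 1) * (degree_sum E S / card S + 1)"
      using assms by (intro mult_mono) auto
    ultimately show ?thesis by simp
  next
    case False
    define m Q D where "m = real (card S)" and "Q = real (degree_sum E S) + card S"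
      and "D = 2 * real (card (neighbours E S v)) + 1"
    have T: "S - {v} \<in> A" using False v sub by (auto simp: A_def)
    have "S - {v} \<noteq> {}" using False v by auto
    then have "card (S - {v}) > 0" using fin by (simp add: card_gt_0_iff)
    then have "card S - 1 > 0" using v by simp
    then have "card S \<ge> 2" by simp
    then have m: "m \<ge> 2" by (simp add: m_def)
    have cT: "real (card (S - {v})) = m - 1" using v m by (simp add: m_def)
    have dT: "real (degree_sum E (S - {v})) + card (S - {v}) = Q - D"
      using degree_sum_remove[OF fin v, of E] cT by (simp add: Q_def D_def m_def)
    have "Q - D > 0" using dT[symmetric] cT m by simp
    moreover have "Q > 0" using m by (simp add: Q_def m_def)
    moreover have "(m - 1) powr (q + 1) / (Q - D) \<le> m powr (q + 1) / Q"
      using max[OF T] unfolding \<psi>_def dT[symmetric] cT[symmetric] by (simp add: Q_def m_def)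
    ultimately have "(m - 1) powr (q + 1) / m powr (q + 1) \<le> (Q - D) / Q"
      using m by (simp add: field_simps)
    then have "((m - 1) / m) powr (q + 1) \<le> (Q - D) / Q" using m by (simp add: powr_divide)
    moreover have "1 + (q + 1) * ((m - 1) / m - 1) \<le> ((m - 1) / m) powr (q + 1)"
      using m assms by (intro Bernoulli_inequality_powr) auto
    ultimately have "1 + (q + 1) * ((m - 1) / m - 1) \<le> (Q - D) / Q" by linarith
    then have "D \<le> (q + 1) * (Q / m)" using m \<open>Q > 0\<close> by (simp add: field_simps)
    also have "Q / m = degree_sum E S / card S + 1" using m by (simp add: Q_def m_def add_divide_distrib)
    finally show ?thesis by (simp add: D_def)
  qed
  ultimately show ?thesis using that sub by blast
qed

section \<open>Asymptotics\<close>

lemma ln_times_powr_antimono: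
  fixes a b c :: real
  assumes "c > 0" "exp (1 / c) \<le> a" "a \<le> b"
  shows "ln b * b powr (- c) \<le> ln a * a powr (- c)"
proof -
  have a: "a > 0" using assms(2) exp_gt_zero[of "1 / c"] by linarith
  have la: "1 / c \<le> ln a" using assms(2) a by (simp add: ln_ge_iff)
  then have la': "ln a > 0" using assms(1) by (smt (verit) divide_pos_pos)
  define r where "r = ln b - ln a"
  have r: "r \<ge> 0" using a assms by (simp add: r_def)
  have "r \<le> ln a * (c * r)"
  proof -
    have "1 \<le> ln a * c" using la assms(1) by (simp add: divide_le_eq)
    from mult_right_mono[OF this r] show ?thesis by (simp add: mult.assoc)
  qed
  then have "ln b \<le> ln a * (1 + c * r)" by (simp add: r_def algebra_simps)
  also have "\<dots> \<le> ln a * exp (c * r)" using la' by (intro mult_left_mono exp_ge_add_one_self) auto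
  finally have "ln b * exp (- c * ln b) \<le> ln a * exp (c * r) * exp (- c * ln b)"
    by (intro mult_right_mono) auto
  also have "\<dots> = ln a * exp (- c * ln a)"
    by (simp add: mult.assoc exp_add[symmetric] r_def algebra_simps)
  finally show ?thesis using a assms by (simp add: powr_def)
qed

text \<open>
  The first term of the maximum in the theorem, with \<open>j = k - 2\<close>.
\<close>

definition shearer_bound :: "nat \<Rightarrow> real \<Rightarrow> real"
  where "shearer_bound j x = ln x / (j * x * ln (ln x))"

text \<open>
  For \<open>x = (1 - \<eta>) ln \<Delta>\<close> the term \<open>e\<^sup>x + 1\<close> of the occupancy bound is of smaller order than
  \<open>\<Delta> / ln \<Delta>\<close>, and the term with \<open>\<gamma>\<close> is asymptotically \<open>j \<Delta> ln (ln \<Delta>) / ((1 - \<eta>)\<^sup>2 ln \<Delta>)\<close>.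
\<close>

lemma shearer_bound_max_degree:
  fixes \<epsilon> :: real
  assumes "j \<ge> 1" "0 < \<epsilon>" "\<epsilon> < 1"
  shows "\<exists>D0. \<forall>(V :: 'a set) E. \<forall>\<Delta> \<ge> D0. finite V \<longrightarrow> clique_free (j + 3) E V \<longrightarrow>
    (\<forall>v\<in>V. real (card (neighbours E V v)) \<le> \<Delta>) \<longrightarrow>
    (1 - \<epsilon>) * shearer_bound j \<Delta> * card V \<le> independence_number V E"
proof -
  define \<eta> where "\<eta> = \<epsilon> / 2"
  define c where "c = (real j + 1) * ln 3 + ln (1 / \<eta>)"
  \<comment> \<open>\<open>\<eta> = \<epsilon> / 2\<close> gives \<open>(1 - \<eta>)\<^sup>2 > 1 - \<epsilon>\<close>.\<close>
  define a where "a = 1 - \<eta>"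
  define J where "J = real j"
  have a: "0 < a" "a < 1" and J: "J > 0" using assms by (auto simp: \<eta>_def a_def J_def)
  have lim: "((\<lambda>x. (ln x / (J * x * ln (ln x))) *
      (exp (a * ln x) + 1 + (J * ln (a * ln x) + c) / (a * (a * ln x)) * x)) \<longlongrightarrow> 1 / (a * a)) at_top"
    using a J by (real_asymp simp: field_simps)
  have "(1 - \<epsilon>) < a * a"
  proof -
    have "a * a = 1 - \<epsilon> + (\<epsilon> / 2) ^ 2" by (simp add: a_def \<eta>_def power2_eq_square field_simps)
    then show ?thesis using assms by simp
  qed
  then have "1 / (a * a) < 1 / (1 - \<epsilon>)" using assms by (intro divide_strict_left_mono) auto
  from order_tendstoD(2)[OF lim this]
  have "\<forall>\<^sub>F x in at_top. (ln x / (J * x * ln (ln x))) *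
      (exp (a * ln x) + 1 + (J * ln (a * ln x) + c) / (a * (a * ln x)) * x) < 1 / (1 - \<epsilon>)" .
  moreover have "\<forall>\<^sub>F x in at_top. ln (a * ln x) \<ge> 1 \<and> a * ln x > 0 \<and> x > 0 \<and> ln (ln x) > 0"
    using a by (intro eventually_conj) real_asymp+
  ultimately have "\<forall>\<^sub>F x in at_top. (ln x / (J * x * ln (ln x))) *
      (exp (a * ln x) + 1 + (J * ln (a * ln x) + c) / (a * (a * ln x)) * x) < 1 / (1 - \<epsilon>)
      \<and> ln (a * ln x) \<ge> 1 \<and> a * ln x > 0 \<and> x > 0 \<and> ln (ln x) > 0"
    by (rule eventually_conj)
  then obtain D0 where D0: "\<And>x. x \<ge> D0 \<Longrightarrow> (ln x / (J * x * ln (ln x))) *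
      (exp (a * ln x) + 1 + (J * ln (a * ln x) + c) / (a * (a * ln x)) * x) < 1 / (1 - \<epsilon>)
      \<and> ln (a * ln x) \<ge> 1 \<and> a * ln x > 0 \<and> x > 0 \<and> ln (ln x) > 0"
    by (auto simp: eventually_at_top_linorder)
  show ?thesis
  proof (intro exI[of _ D0] allI impI)
    fix V :: "'a set" and E \<Delta>
    assume D: "\<Delta> \<ge> D0" and V: "finite V" "clique_free (j + 3) E V"
      and deg: "\<forall>v\<in>V. real (card (neighbours E V v)) \<le> \<Delta>"
    define M where "M = exp (a * ln \<Delta>) + 1 + (J * ln (a * ln \<Delta>) + c) / (a * (a * ln \<Delta>)) * \<Delta>"
    note D = D0[OF D, folded M_def]
    have F: "shearer_bound j \<Delta> = ln \<Delta> / (J * \<Delta> * ln (ln \<Delta>))" by (simp add: shearer_bound_def J_def)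
    have pos: "ln \<Delta> > 0" using D a by (simp add: zero_less_mult_iff)
    then have F0: "shearer_bound j \<Delta> \<ge> 0" unfolding F using D J by (intro divide_nonneg_nonneg) auto
    have "real (card V) \<le> real (independence_number V E) * M"
      unfolding M_def c_def J_def a_def
      using V deg assms D by (intro card_le_independence_number_clique_free) (auto simp: \<eta>_def a_def)
    then have "(1 - \<epsilon>) * shearer_bound j \<Delta> * card V \<le>
        (1 - \<epsilon>) * shearer_bound j \<Delta> * (real (independence_number V E) * M)"
      using F0 assms by (intro mult_left_mono) auto
    also have "\<dots> = real (independence_number V E) * ((1 - \<epsilon>) * (shearer_bound j \<Delta> * M))" by simp
    also have "\<dots> \<le> real (independence_number V E) * 1"
      using D assms unfolding F by (intro mult_left_mono) (auto simp: less_divide_eq mult.commute)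
    finally show "(1 - \<epsilon>) * shearer_bound j \<Delta> * card V \<le> independence_number V E" by simp
  qed
qed

lemma shearer_bound_powr_antimono:
  assumes "0 < c" "exp (1 / c) \<le> a" "exp 1 < a" "a \<le> b" "j \<ge> 1"
  shows "shearer_bound j b * b powr (1 - c) \<le> shearer_bound j a * a powr (1 - c)"
proof -
  have eq: "shearer_bound j x * x powr (1 - c) = (ln x * x powr (- c)) / (j * ln (ln x))" if "x > 0" for x
    using that by (simp add: shearer_bound_def powr_diff powr_minus field_simps)
  have a: "a > 0" using assms(3) exp_gt_zero[of 1] by linarith
  have la: "ln a > 1" using assms(3) a by (metis exp_less_cancel_iff exp_ln)
  have lab: "ln a \<le> ln b" using a assms by simp
  have "ln b * b powr (- c) / (j * ln (ln b)) \<le> ln a * a powr (- c) / (j * ln (ln a))"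
  proof (rule frac_le)
    show "ln b * b powr (- c) \<le> ln a * a powr (- c)"
      using assms by (intro ln_times_powr_antimono) auto
    show "j * ln (ln a) \<le> j * ln (ln b)" using la lab by (intro mult_left_mono) auto
    show "0 < j * ln (ln a)" using la assms by simp
    show "0 \<le> ln a * a powr (- c)" using la by simp
  qed
  then show ?thesis using eq a assms by simp
qed

lemma real_card_le_independence_number_times:
  fixes y :: real
  assumes "finite W" "y \<ge> 0" "\<And>v. v \<in> W \<Longrightarrow> real (card (neighbours E W v)) \<le> y"
  shows "real (card W) \<le> real (independence_number W E) * (y + 1)"
proof -
  have "card W \<le> independence_number W E * (nat \<lfloor>y\<rfloor> + 1)"
    using assms by (intro card_le_independence_number_times) (auto simp: le_nat_floor)
  then have "real (card W) \<le> real (independence_number W E * (nat \<lfloor>y\<rfloor> + 1))"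
    by (intro of_nat_mono)
  also have "\<dots> \<le> real (independence_number W E) * (y + 1)"
    unfolding of_nat_mult using assms(2) by (intro mult_left_mono) auto
  finally show ?thesis .
qed

text \<open>
  Take the balanced subset \<open>S\<close> for \<open>q = 1 + 2 \<delta>\<close>, let \<open>y\<close> be the bound for the degrees in \<open>S\<close>, and
  put \<open>s = 1 / q < 1\<close>. Maximality gives \<open>|V| z\<^sup>-\<^sup>s \<le> |S| y\<^sup>-\<^sup>s\<close>, so a drop of the average degree is
  overcompensated by the polynomial factor \<open>(z / y)\<^sup>1\<^sup>-\<^sup>s\<close> in \<open>|S| / y\<close>. This outweighs the loss of
  \<open>ln z\<close> to \<open>ln y\<close> by \<open>shearer_bound_powr_antimono\<close> as long as \<open>y\<close> is large. If \<open>y\<close> is bounded, the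
  trivial bound \<open>|S| / (y + 1)\<close> suffices.
\<close>

lemma shearer_bound_average_degree:
  fixes \<epsilon> \<delta> :: real
  assumes j: "j \<ge> 1" and eps: "0 < \<epsilon>" "\<epsilon> < 1" and del: "0 < \<delta>"
  shows "\<exists>Z0. \<forall>(V :: 'a set) E. \<forall>z \<ge> Z0. finite V \<longrightarrow> V \<noteq> {} \<longrightarrow> clique_free (j + 3) E V \<longrightarrow>
    z = (1 + \<delta>) * (degree_sum E V / card V + 1) \<longrightarrow>
    (1 - \<epsilon>) * shearer_bound j z * card V \<le> independence_number V E"
proof -
  obtain D0 where D0: "\<And>(V :: 'a set) E \<Delta>. \<Delta> \<ge> D0 \<Longrightarrow> finite V \<Longrightarrow> clique_free (j + 3) E V \<Longrightarrow>
    (\<forall>v\<in>V. real (card (neighbours E V v)) \<le> \<Delta>) \<Longrightarrow>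
    (1 - \<epsilon>) * shearer_bound j \<Delta> * card V \<le> independence_number V E"
    using shearer_bound_max_degree[OF j eps, where 'a = 'a] by blast
  define q where "q = 1 + 2 * \<delta>"
  define s where "s = 1 / q"
  define c where "c = 1 - s"
  have q: "q > 1" using del by (simp add: q_def)
  have s: "0 < s" "s < 1" using q by (auto simp: s_def)
  have c: "0 < c" using s by (simp add: c_def)
  define Y where "Y = max D0 (max (exp (1 / c)) (exp 2))"
  have Y: "D0 \<le> Y" "exp (1 / c) \<le> Y" "exp 2 \<le> Y" by (auto simp: Y_def)
  have Y1: "exp 1 < Y" using Y(3) by (smt (verit) exp_less_cancel_iff)
  have Y0: "Y > 0" using Y1 exp_gt_zero[of 1] by linarith
  define J where "J = real j"
  have J: "J > 0" using j by (simp add: J_def)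
  have "((\<lambda>z. (ln z / (J * z * ln (ln z))) * z powr s * (Y + 1)) \<longlongrightarrow> 0) at_top"
    using s J Y0 by real_asymp
  then have "\<forall>\<^sub>F z in at_top. (ln z / (J * z * ln (ln z))) * z powr s * (Y + 1) < 1"
    by (rule order_tendstoD) simp
  moreover have "\<forall>\<^sub>F z in at_top. z > 0 \<and> ln z > 0 \<and> ln (ln z) > (0::real)"
    by (intro eventually_conj) real_asymp+
  ultimately have "\<forall>\<^sub>F z in at_top. (ln z / (J * z * ln (ln z))) * z powr s * (Y + 1) < 1
      \<and> z > 0 \<and> ln z > 0 \<and> ln (ln z) > 0"
    by (rule eventually_conj)
  then obtain Z0 where Z0: "\<And>z. z \<ge> Z0 \<Longrightarrow> (ln z / (J * z * ln (ln z))) * z powr s * (Y + 1) < 1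
      \<and> z > 0 \<and> ln z > 0 \<and> ln (ln z) > 0"
    by (auto simp: eventually_at_top_linorder)
  show ?thesis
  proof (intro exI[of _ Z0] allI impI)
    fix V :: "'a set" and E z
    assume "z \<ge> Z0" and V: "finite V" "V \<noteq> {}" "clique_free (j + 3) E V"
      and z: "z = (1 + \<delta>) * (degree_sum E V / card V + 1)"
    note Z = Z0[OF \<open>z \<ge> Z0\<close>, folded J_def]
    have F0: "shearer_bound j z \<ge> 0" unfolding shearer_bound_def using Z by (intro divide_nonneg_nonneg) auto
    from exists_balanced_subset[OF V(1,2), of q E] q
    obtain S where S: "S \<subseteq> V" "S \<noteq> {}"
      and bal: "real (card V) powr q / (degree_sum E V / card V + 1)
        \<le> real (card S) powr q / (degree_sum E S / card S + 1)"
      and deg: "\<And>v. v \<in> S \<Longrightarrow>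
        2 * real (card (neighbours E S v)) + 1 \<le> (q + 1) * (degree_sum E S / card S + 1)"
      by auto
    have finS: "finite S" using S V finite_subset by blast
    define n m where "n = real (card V)" and "m = real (card S)"
    define y where "y = (1 + \<delta>) * (degree_sum E S / card S + 1)"
    have nm: "0 < m" "m \<le> n" using S V finS by (auto simp: n_def m_def card_gt_0_iff card_mono)
    have "1 * 1 \<le> y" unfolding y_def using del by (intro mult_mono) auto
    then have y: "y \<ge> 1" by simp
    have z0: "z > 0" using Z by simp
    have bal': "n powr q / z \<le> m powr q / y"
    proof -
      have "(n powr q / (degree_sum E V / card V + 1)) / (1 + \<delta>)
          \<le> (m powr q / (degree_sum E S / card S + 1)) / (1 + \<delta>)"
        using bal del unfolding n_def m_def by (intro divide_right_mono) auto
      then show ?thesis by (simp add: z y_def mult.commute)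
    qed
    have "y \<le> z"
    proof -
      have "n powr q * y \<le> m powr q * z" using bal' y z0 by (simp add: field_simps)
      also have "\<dots> \<le> n powr q * z" using nm q z0 by (intro mult_right_mono powr_mono2) auto
      finally show ?thesis using nm by simp
    qed
    have dens: "n * z powr (- s) \<le> m * y powr (- s)"
    proof -
      have "(n powr q / z) powr s \<le> (m powr q / y) powr s"
        using bal' s z0 by (intro powr_mono2) auto
      moreover have "(x powr q / w) powr s = x * w powr (- s)" if "x > 0" "w > 0" for x w
      proof -
        have "(x powr q / w) powr s = (x powr q) powr s / w powr s"
          by (rule powr_divide)
        then show ?thesis using that q by (simp add: powr_powr powr_minus divide_inverse s_def)
      qed
      ultimately show ?thesis using nm y z0 by simp
    qed
    have degy: "real (card (neighbours E S v)) \<le> y" if "v \<in> S" for v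
    proof -
      have "q + 1 = 2 * (1 + \<delta>)" by (simp add: q_def)
      then have "2 * real (card (neighbours E S v)) + 1 \<le> 2 * y"
        using deg[OF that] by (simp only: y_def mult.assoc)
      then show ?thesis by simp
    qed
    have mono: "real (independence_number S E) \<le> real (independence_number V E)"
      using independence_number_mono[OF V(1) S(1)] by simp
    have "(1 - \<epsilon>) * shearer_bound j z * n \<le> independence_number S E"
    proof (cases "Y \<le> y")
      case True
      have h: "shearer_bound j z * z powr s \<le> shearer_bound j y * y powr s"
        using shearer_bound_powr_antimono[of c y z j] c True Y Y1 \<open>y \<le> z\<close> j by (simp add: c_def)
      have "shearer_bound j z * n = (shearer_bound j z * z powr s) * (n * z powr (- s))"
        using z0 by (simp add: powr_minus)
      also have "\<dots> \<le> (shearer_bound j z * z powr s) * (m * y powr (- s))"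
        using dens F0 by (intro mult_left_mono) auto
      also have "\<dots> \<le> (shearer_bound j y * y powr s) * (m * y powr (- s))"
        using h nm by (intro mult_right_mono) auto
      also have "\<dots> = shearer_bound j y * m" using y by (simp add: powr_minus)
      finally have "(1 - \<epsilon>) * (shearer_bound j z * n) \<le> (1 - \<epsilon>) * (shearer_bound j y * m)"
        using eps by (intro mult_left_mono) auto
      also have "\<dots> \<le> independence_number S E"
        using D0[of y S E] True Y finS degy clique_free_mono[OF V(3) S(1)]
        by (simp add: m_def mult.assoc)
      finally show ?thesis by (simp add: mult.assoc)
    next
      case False
      have "m * y powr (- s) \<le> m * 1"
        using y s nm by (intro mult_left_mono) (auto simp: powr_minus inverse_le_1_iff ge_one_powr_ge_zero)
      also have "m \<le> real (independence_number S E) * (y + 1)"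
        unfolding m_def using finS degy y by (intro real_card_le_independence_number_times) auto
      also have "\<dots> \<le> real (independence_number S E) * (Y + 1)"
        using False by (intro mult_left_mono) auto
      finally have ub: "n * z powr (- s) \<le> real (independence_number S E) * (Y + 1)"
        using dens by simp
      have "shearer_bound j z * n = (shearer_bound j z * z powr s) * (n * z powr (- s))"
        using z0 by (simp add: powr_minus)
      also have "\<dots> \<le> (shearer_bound j z * z powr s) * (real (independence_number S E) * (Y + 1))"
        using ub F0 by (intro mult_left_mono) auto
      also have "\<dots> = (shearer_bound j z * z powr s * (Y + 1)) * real (independence_number S E)" by simp
      also have "\<dots> \<le> 1 * real (independence_number S E)"
        using Z by (intro mult_right_mono) (auto simp: shearer_bound_def J_def)
      finally have "shearer_bound j z * n \<le> independence_number S E" by simp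
      moreover have "(1 - \<epsilon>) * (shearer_bound j z * n) \<le> 1 * (shearer_bound j z * n)"
        using eps F0 nm by (intro mult_right_mono) auto
      ultimately show ?thesis by (simp add: mult.assoc)
    qed
    then show "(1 - \<epsilon>) * shearer_bound j z * card V \<le> independence_number V E"
      using mono by (simp add: n_def)
  qed
qed

text \<open>
  For fixed \<open>j\<close> the second term of the maximum is of order \<open>sqrt (ln d) / d\<close>, hence eventually the
  smaller one.
\<close>

lemma eventually_max_eq_shearer_bound:
  fixes j :: nat
  assumes "j \<ge> 1"
  shows "\<forall>\<^sub>F d in at_top. 0 \<le> shearer_bound j d \<and>
    max (shearer_bound j d) (1 / (5 * d) * sqrt (ln d / ln (real j + 1))) = shearer_bound j d"
proof -
  define J where "J = real j"
  define l where "l = ln (real j + 1)"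
  have J: "J > 0" and l: "l > 0" using assms by (auto simp: J_def l_def)
  have "((\<lambda>d. (1 / (5 * d) * sqrt (ln d / l)) / (ln d / (J * d * ln (ln d)))) \<longlongrightarrow> 0) at_top"
    using J l by real_asymp
  then have "\<forall>\<^sub>F d in at_top. (1 / (5 * d) * sqrt (ln d / l)) / (ln d / (J * d * ln (ln d))) < 1"
    by (rule order_tendstoD) simp
  moreover have "\<forall>\<^sub>F d in at_top. ln d / (J * d * ln (ln d)) > 0"
    using J by real_asymp
  ultimately show ?thesis
  proof eventually_elim
    case (elim d)
    then have "1 / (5 * d) * sqrt (ln d / l) < ln d / (J * d * ln (ln d))"
      by (simp only: pos_divide_less_eq mult_1)
    then show ?case using elim(2) by (auto simp: shearer_bound_def J_def l_def)
  qed
qed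

text \<open>
  The shifted argument costs a factor \<open>1 / (1 + \<epsilon> / 2)\<close> in the limit, and
  \<open>(1 - \<epsilon>) (1 + \<epsilon> / 2) < 1 - \<epsilon> / 2\<close>.
\<close>

lemma eventually_shearer_bound_shift:
  fixes j :: nat and \<epsilon> :: real
  assumes "j \<ge> 1" "0 < \<epsilon>" "\<epsilon> < 1"
  shows "\<forall>\<^sub>F d in at_top.
    (1 - \<epsilon>) * shearer_bound j d \<le> (1 - \<epsilon> / 2) * shearer_bound j ((1 + \<epsilon> / 2) * (d + 1))"
proof -
  define J where "J = real j"
  define \<delta> where "\<delta> = \<epsilon> / 2"
  have J: "J > 0" and \<delta>: "0 < \<delta>" "\<delta> < 1" using assms by (auto simp: J_def \<delta>_def)
  define a where "a = 1 + \<delta>"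
  have a: "a > 1" using \<delta> by (simp add: a_def)
  have "((\<lambda>d. (ln (a * (d + 1)) / (J * (a * (d + 1)) * ln (ln (a * (d + 1))))) /
      (ln d / (J * d * ln (ln d)))) \<longlongrightarrow> 1 / a) at_top"
    using J a by (real_asymp simp: field_simps)
  moreover have "(1 - \<epsilon>) / (1 - \<delta>) < 1 / a"
  proof -
    have "(1 - \<epsilon>) * (1 + \<delta>) = (1 - \<delta>) - 2 * \<delta> ^ 2"
      by (simp add: \<delta>_def power2_eq_square field_simps)
    also have "\<dots> < 1 - \<delta>" using \<delta> by simp
    finally show ?thesis using \<delta> by (simp add: a_def field_simps)
  qed
  ultimately have "\<forall>\<^sub>F d in at_top. (1 - \<epsilon>) / (1 - \<delta>) <
      (ln (a * (d + 1)) / (J * (a * (d + 1)) * ln (ln (a * (d + 1))))) /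
      (ln d / (J * d * ln (ln d)))"
    by (rule order_tendstoD)
  moreover have "\<forall>\<^sub>F d in at_top. ln d / (J * d * ln (ln d)) > 0"
    using J by real_asymp
  ultimately have "\<forall>\<^sub>F d in at_top. (1 - \<epsilon>) / (1 - \<delta>) <
      shearer_bound j (a * (d + 1)) / shearer_bound j d \<and> shearer_bound j d > 0"
    by eventually_elim (simp add: shearer_bound_def J_def)
  then show ?thesis
  proof eventually_elim
    case (elim d)
    then have "(1 - \<epsilon>) / (1 - \<delta>) * shearer_bound j d < shearer_bound j (a * (d + 1))"
      using pos_less_divide_eq by blast
    then have "(1 - \<epsilon>) * shearer_bound j d < (1 - \<delta>) * shearer_bound j (a * (d + 1))"
      using \<delta> by (simp add: field_simps)
    then show ?case by (simp add: a_def \<delta>_def)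
  qed
qed

theorem corollary2p8:
  fixes k :: nat and \<epsilon> :: real
  assumes "k \<ge> 3" and "\<epsilon> > 0"
  shows "\<exists>d0::real. \<forall>(V :: 'a set) (E :: 'a set set) (d :: real).
    simple_graph V E \<longrightarrow> complete_free (k + 1) V E \<longrightarrow>
    d = average_degree V E \<longrightarrow> d \<ge> d0 \<longrightarrow>
      real (independence_number V E) \<ge>
        (1 - \<epsilon>) *
        max (ln d / ((real k - 2) * d * ln (ln d)))
            (1 / (5 * d) * sqrt (ln d / ln (real k - 1))) *
        real (card V)"
proof -
  define j where "j = k - 2"
  have j: "j \<ge> 1" "k + 1 = j + 3" "real k - 2 = real j" "real k - 1 = real j + 1"
    using assms by (auto simp: j_def)
  \<comment> \<open>Since the maximum is eventually nonnegative, lowering \<open>\<epsilon>\<close> only strengthens the claim.\<close>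
  define e where "e = min \<epsilon> (1 / 2)"
  have e: "0 < e" "e < 1" "e \<le> \<epsilon>" using assms by (auto simp: e_def)
  have "0 < e / 2" "e / 2 < 1" using e by auto
  from shearer_bound_average_degree[OF j(1) this this(1), where 'a = 'a]
  obtain Z0 where Z0: "\<And>(V :: 'a set) E z. z \<ge> Z0 \<Longrightarrow> finite V \<Longrightarrow> V \<noteq> {} \<Longrightarrow>
    clique_free (j + 3) E V \<Longrightarrow> z = (1 + e / 2) * (degree_sum E V / card V + 1) \<Longrightarrow>
    (1 - e / 2) * shearer_bound j z * card V \<le> independence_number V E"
    by blast
  have "\<forall>\<^sub>F d in at_top. (0 \<le> shearer_bound j d \<and>
      max (shearer_bound j d) (1 / (5 * d) * sqrt (ln d / ln (real j + 1))) = shearer_bound j d) \<and>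
    (1 - e) * shearer_bound j d \<le> (1 - e / 2) * shearer_bound j ((1 + e / 2) * (d + 1)) \<and>
    (1 + e / 2) * (d + 1) \<ge> Z0 \<and> d > 0"
  proof (intro eventually_conj)
    show "\<forall>\<^sub>F d in at_top. (1 + e / 2) * (d + 1) \<ge> Z0" using e by real_asymp
  qed (use eventually_max_eq_shearer_bound[OF j(1)] eventually_shearer_bound_shift[OF j(1) e(1,2)] in
      \<open>auto simp: eventually_conj_iff eventually_gt_at_top\<close>)
  then obtain d0 where d0: "\<And>d. d \<ge> d0 \<Longrightarrow> (0 \<le> shearer_bound j d \<and>
      max (shearer_bound j d) (1 / (5 * d) * sqrt (ln d / ln (real j + 1))) = shearer_bound j d) \<and>
    (1 - e) * shearer_bound j d \<le> (1 - e / 2) * shearer_bound j ((1 + e / 2) * (d + 1)) \<and>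
    (1 + e / 2) * (d + 1) \<ge> Z0 \<and> d > 0"
    by (auto simp: eventually_at_top_linorder)
  show ?thesis
  proof (intro exI[of _ d0] allI impI)
    fix V :: "'a set" and E d
    assume G: "simple_graph V E" "complete_free (k + 1) V E"
      and d: "d = average_degree V E" and "d \<ge> d0"
    note D = d0[OF \<open>d \<ge> d0\<close>]
    have V: "finite V" using G by (simp add: simple_graph_def)
    have "V \<noteq> {}" using D d by (auto simp: average_degree_def)
    have davg: "degree_sum E V / card V = d"
      using degree_sum_eq_twice_card_edges[OF G(1)] by (simp add: d average_degree_def)
    have cf: "clique_free (j + 3) E V"
      using complete_free_imp_clique_free[OF G] unfolding j(2) .
    have "(1 - \<epsilon>) * shearer_bound j d \<le> (1 - e) * shearer_bound j d"
      using e D by (intro mult_right_mono) auto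
    also have "\<dots> \<le> (1 - e / 2) * shearer_bound j ((1 + e / 2) * (d + 1))" using D by simp
    finally have "(1 - \<epsilon>) * shearer_bound j d * card V
        \<le> (1 - e / 2) * shearer_bound j ((1 + e / 2) * (d + 1)) * card V"
      by (intro mult_right_mono) auto
    also have "\<dots> \<le> independence_number V E"
      using D V \<open>V \<noteq> {}\<close> cf davg by (intro Z0) auto
    finally show "(1 - \<epsilon>) * max (ln d / ((real k - 2) * d * ln (ln d)))
        (1 / (5 * d) * sqrt (ln d / ln (real k - 1))) * real (card V)
        \<le> real (independence_number V E)"
      using D unfolding j(3,4) shearer_bound_def by simp
  qed
qed

end
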